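(* Let $J$ be a finite-dimensional simple Jordan algebra over $\mathbb{C}$, and let $X$ be the set of all its idempotents. There do not exist a nonzero complex vector space $V$ and a symmetric bilinear map $\theta\colon J\times J\to V$ such that the central extension $J_\theta$ is non-split and is $\mathcal{J}(\frac12)$-axial with respect to the set $Y=\{a+\theta(a,a)\mid a\in X\}$.
   Context: A Jordan algebra is a commutative algebra satisfying $(xy)x^2=x(yx^2)$. Idempotents are understood to be nonzero. For a vector space $V$ (of arbitrary dimension) and a bilinear map $\theta\colon\mathbf{A}\times\mathbf{A}\to V$, the central extension $\mathbf{A}_\theta$ of the algebra $\mathbf{A}$ by $V$ is the vector space $\mathbf{A}\dotplus V$ with product $[x+v,y+w]_\theta=xy+\theta(x,y)$. It is split if $\mathbf{A}_\theta=I\oplus I'$ (direct sum of algebras) for an ideal $I$ and a nonzero subalgebra $I'$ of $\mathrm{Ann}(\mathbf{A}_\theta)$; otherwise it is non-split. For an element $a$ of a commutative algebra $\mathbf{B}$: $L_a\colon y\mapsto ay$, $\mathrm{Spec}(a)$ is the set of eigenvalues of $L_a$, $\mathbf{B}^a_\lambda$ is the $\lambda$-eigenspace of $L_a$ (zero if $\lambda\notin \mathrm{Spec}(a)$), and $\mathbf{B}^a_S=\bigoplus_{\lambda\in S}\mathbf{B}^a_\lambda$, $\mathbf{B}^a_\emptyset=0$. The element $a$ is semisimple if every element of $\mathbf{B}$ lies in a finite-dimensional $L_a$-stable subspace and $L_a$ is diagonalisable on every finite-dimensional $L_a$-stable subspace. The fusion law $\mathcal{J}(\frac12)$ is the symmetric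 operation $\star$ from pairs of elements of $\{1,0,\frac12\}$ to subsets of $\{1,0,\frac12\}$ given by $1\star1=\{1\}$, $1\star0=\emptyset$, $1\star\frac12=\{\frac12\}$, $0\star0=\{0\}$, $0\star\frac12=\{\frac12\}$, $\frac12\star\frac12=\{1,0\}$. A $\mathcal{J}(\frac12)$-axis of $\mathbf{B}$ is a semisimple idempotent $a$ with $\mathrm{Spec}(a)\subseteq\{1,0,\frac12\}$ and $\mathbf{B}^a_\lambda\mathbf{B}^a_\mu\subseteq\mathbf{B}^a_{\lambda\star\mu}$ for all $\lambda,\mu\in\mathrm{Spec}(a)$. $\mathbf{B}$ is $\mathcal{J}(\frac12)$-axial with respect to $Y$ if it is commutative, every element of $Y$ is a $\mathcal{J}(\frac12)$-axis of $\mathbf{B}$, and $Y$ generates $\mathbf{B}$ as an algebra ($Y$ is allowed to be infinite here). *)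

theory Defs
  imports Complex_Main "HOL-Analysis.Product_Vector"
begin

section \<open>Non-associative complex algebras\<close>

text \<open>
  The scalar multiplication is an explicit parameter, since there is no type class of complex
  vector spaces of arbitrary dimension without a norm. Algebras need not be unital or associative.
\<close>

locale nonassoc_algebra = vector_space scale
  for scale :: "complex \<Rightarrow> 'a::ab_group_add \<Rightarrow> 'a"  (infixr \<open>\<cdot>\<close> 75) +
  fixes mult :: "'a \<Rightarrow> 'a \<Rightarrow> 'a"  (infixl \<open>\<star>\<close> 70)
  assumes linear_mult_right: "Vector_Spaces.linear scale scale (\<lambda>y. x \<star> y)"
    and linear_mult_left: "Vector_Spaces.linear scale scale (\<lambda>x. x \<star> y)"
begin

definition commutative :: bool
  where "commutative \<longleftrightarrow> (\<forall>x y. x \<star> y = y \<star> x)"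

definition jordan :: bool
  where "jordan \<longleftrightarrow> commutative \<and> (\<forall>x y. (x \<star> y) \<star> (x \<star> x) = x \<star> (y \<star> (x \<star> x)))"

definition subalgebra :: "'a set \<Rightarrow> bool"
  where "subalgebra S \<longleftrightarrow> subspace S \<and> (\<forall>x\<in>S. \<forall>y\<in>S. x \<star> y \<in> S)"

definition ideal :: "'a set \<Rightarrow> bool"
  where "ideal I \<longleftrightarrow> subspace I \<and> (\<forall>x\<in>I. \<forall>y. x \<star> y \<in> I \<and> y \<star> x \<in> I)"

definition simple :: bool
  where "simple \<longleftrightarrow> (\<exists>x y. x \<star> y \<noteq> 0) \<and> (\<forall>I. ideal I \<longrightarrow> I = {0} \<or> I = UNIV)"

definition finite_dimensional :: "'a set \<Rightarrow> bool"
  where "finite_dimensional W \<longleftrightarrow> (\<exists>B. finite B \<and> span B = W)"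

definition Ann :: "'a set"
  where "Ann = {x. \<forall>y. x \<star> y = 0 \<and> y \<star> x = 0}"

definition direct_sum :: "'a set \<Rightarrow> 'a set \<Rightarrow> bool"
  where "direct_sum I I' \<longleftrightarrow> subalgebra I \<and> subalgebra I' \<and>
    (\<forall>x\<in>I. \<forall>y\<in>I'. x \<star> y = 0 \<and> y \<star> x = 0) \<and>
    I \<inter> I' = {0} \<and> {x + y | x y. x \<in> I \<and> y \<in> I'} = UNIV"

definition split :: bool
  where "split \<longleftrightarrow>
    (\<exists>I I'. ideal I \<and> subalgebra I' \<and> I' \<subseteq> Ann \<and> I' \<noteq> {0} \<and> direct_sum I I')"

definition idempotent :: "'a \<Rightarrow> bool"
  where "idempotent a \<longleftrightarrow> a \<noteq> 0 \<and> a \<star> a = a"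

definition eigenspace :: "'a \<Rightarrow> complex \<Rightarrow> 'a set"
  where "eigenspace a \<alpha> = {y. a \<star> y = \<alpha> \<cdot> y}"

definition Spec :: "'a \<Rightarrow> complex set"
  where "Spec a = {\<alpha>. \<exists>y. y \<noteq> 0 \<and> a \<star> y = \<alpha> \<cdot> y}"

text \<open>
  The span of the union is the sum of the eigenspaces, which is automatically direct because the
  eigenvalues are distinct. It is \<open>{0}\<close> for \<open>S = {}\<close>.
\<close>
definition eigenspace_sum :: "'a \<Rightarrow> complex set \<Rightarrow> 'a set"
  where "eigenspace_sum a S = span (\<Union>\<alpha>\<in>S. eigenspace a \<alpha>)"

definition stable :: "'a \<Rightarrow> 'a set \<Rightarrow> bool"
  where "stable a W \<longleftrightarrow> (\<forall>y\<in>W. a \<star> y \<in> W)"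

definition diagonalisable_on :: "'a \<Rightarrow> 'a set \<Rightarrow> bool"
  where "diagonalisable_on a W \<longleftrightarrow>
    (\<exists>B. independent B \<and> span B = W \<and> (\<forall>b\<in>B. \<exists>\<alpha>. a \<star> b = \<alpha> \<cdot> b))"

definition semisimple :: "'a \<Rightarrow> bool"
  where "semisimple a \<longleftrightarrow>
    (\<forall>x. \<exists>W. subspace W \<and> finite_dimensional W \<and> stable a W \<and> x \<in> W) \<and>
    (\<forall>W. subspace W \<and> finite_dimensional W \<and> stable a W \<longrightarrow> diagonalisable_on a W)"

end

section \<open>Axes and axial algebras for the Jordan fusion law\<close>

text \<open>Only the values on the set \<open>{1, 0, 1/2}\<close> are meaningful.\<close>
definition jordan_half_fusion :: "complex \<Rightarrow> complex \<Rightarrow> complex set"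
  where "jordan_half_fusion \<alpha> \<beta> =
    (if \<alpha> = 1 \<and> \<beta> = 1 then {1}
     else if \<alpha> = 0 \<and> \<beta> = 0 then {0}
     else if \<alpha> = 1/2 \<and> \<beta> = 1/2 then {1, 0}
     else if \<alpha> = 1/2 \<and> \<beta> \<in> {1, 0} \<or> \<alpha> \<in> {1, 0} \<and> \<beta> = 1/2 then {1/2}
     else {})"

context nonassoc_algebra
begin

definition jordan_half_axis :: "'a \<Rightarrow> bool"
  where "jordan_half_axis a \<longleftrightarrow> idempotent a \<and> semisimple a \<and> Spec a \<subseteq> {1, 0, 1/2} \<and>
    (\<forall>\<alpha>\<in>Spec a. \<forall>\<beta>\<in>Spec a. \<forall>x\<in>eigenspace a \<alpha>. \<forall>y\<in>eigenspace a \<beta>.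
      x \<star> y \<in> eigenspace_sum a (jordan_half_fusion \<alpha> \<beta>))"

definition jordan_half_axial :: "'a set \<Rightarrow> bool"
  where "jordan_half_axial Y \<longleftrightarrow>
    commutative \<and> (\<forall>a\<in>Y. jordan_half_axis a) \<and> subalgebra hull Y = UNIV"

end

section \<open>Central extensions\<close>

definition bilinear_map ::
  "(complex \<Rightarrow> 'a::ab_group_add \<Rightarrow> 'a) \<Rightarrow> (complex \<Rightarrow> 'v::ab_group_add \<Rightarrow> 'v) \<Rightarrow>
   ('a \<Rightarrow> 'a \<Rightarrow> 'v) \<Rightarrow> bool"
  where "bilinear_map sA sV \<theta> \<longleftrightarrow>
    (\<forall>x. Vector_Spaces.linear sA sV (\<lambda>y. \<theta> x y)) \<and>
    (\<forall>y. Vector_Spaces.linear sA sV (\<lambda>x. \<theta> x y))"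

text \<open>
  The pair \<open>(x, v)\<close> stands for \<open>x + v\<close>; the scalar multiplication of the extension is the
  componentwise \<^const>\<open>module_prod.scale\<close>.
\<close>
definition ext_mult ::
  "('a \<Rightarrow> 'a \<Rightarrow> 'a) \<Rightarrow> ('a \<Rightarrow> 'a \<Rightarrow> 'v) \<Rightarrow> 'a \<times> 'v \<Rightarrow> 'a \<times> 'v \<Rightarrow> 'a \<times> 'v"
  where "ext_mult mA \<theta> p q = (mA (fst p) (fst q), \<theta> (fst p) (fst q))"

lemma nonassoc_algebra_central_extension:
  assumes "nonassoc_algebra sA mA" "vector_space sV" "bilinear_map sA sV \<theta>"
  shows "nonassoc_algebra (module_prod.scale sA sV) (ext_mult mA \<theta>)"
proof -
  interpret A: nonassoc_algebra sA mA by fact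
  interpret V: vector_space sV by fact
  interpret P: vector_space_prod sA sV ..
  have th: "Vector_Spaces.linear sA sV (\<lambda>y. \<theta> x y)" "Vector_Spaces.linear sA sV (\<lambda>x. \<theta> x y)" for x y
    using assms(3) by (auto simp: bilinear_map_def)
  note m = A.linear_mult_right[THEN Vector_Spaces.linear.axioms(3)]
    A.linear_mult_left[THEN Vector_Spaces.linear.axioms(3)]
    th(1)[THEN Vector_Spaces.linear.axioms(3)] th(2)[THEN Vector_Spaces.linear.axioms(3)]
  show ?thesis
    by unfold_locales
      (auto simp: ext_mult_def P.scale_def m[THEN module_hom.add] m[THEN module_hom.scale])
qed

end

theory Submission
  imports Defs
begin

text \<open>
  The trace form \<open>\<tau>(x, y) = tr L\<^bsub>x y\<^esub>\<close> of a finite-dimensional Jordan algebra is associative.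
  Since the axes generate the extension, \<open>J\<close> has an idempotent \<open>e\<close>, and \<open>tr L\<^sub>e \<noteq> 0\<close> because
  \<open>L\<^sub>e\<close> is diagonalisable with eigenvalues in \<open>{1, 0, 1/2}\<close>. So the radical of \<open>\<tau>\<close>, an ideal, is
  zero, and the element \<open>c\<close> with \<open>\<tau>(c, x) = tr L\<^sub>x\<close> is a unit of \<open>J\<close>. The rule \<open>1 \<star> 1 = {1}\<close>
  for the axis over \<open>c\<close> now reads \<open>\<theta>(x, y) = \<theta>(c, x y)\<close>, so \<open>\<theta>\<close> is a coboundary and the
  extension splits.
\<close>

section \<open>Trace of an operator in a fixed basis\<close>

context finite_dimensional_vector_space
begin

definition trace :: "('b \<Rightarrow> 'b) \<Rightarrow> 'a"
  where "trace T = (\<Sum>b\<in>Basis. representation Basis (T b) b)"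

lemma representation_Basis_add:
  "representation Basis (x + y) b = representation Basis x b + representation Basis y b"
  by (simp add: representation_add independent_Basis span_Basis)

lemma representation_Basis_diff:
  "representation Basis (x - y) b = representation Basis x b - representation Basis y b"
  by (simp add: representation_diff independent_Basis span_Basis)

lemma representation_Basis_scale:
  "representation Basis (scale r x) b = r * representation Basis x b"
  by (simp add: representation_scale independent_Basis span_Basis)

lemma representation_Basis_sum:
  "representation Basis (sum f A) b = (\<Sum>i\<in>A. representation Basis (f i) b)"
  by (simp add: representation_sum independent_Basis span_Basis)

lemma sum_representation_Basis: "(\<Sum>b\<in>Basis. scale (representation Basis x b) b) = x"
  by (rule sum_representation_eq) (auto simp: independent_Basis span_Basis finite_Basis)

lemma trace_add: "trace (\<lambda>x. S x + T x) = trace S + trace T"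
  by (simp add: trace_def representation_Basis_add sum.distrib)

lemma trace_diff: "trace (\<lambda>x. S x - T x) = trace S - trace T"
  by (simp add: trace_def representation_Basis_diff sum_subtractf)

lemma trace_scale: "trace (\<lambda>x. scale r (T x)) = r * trace T"
  by (simp add: trace_def representation_Basis_scale sum_distrib_left)

text \<open>Expanding the image of each basis vector under the inner map turns both traces into
  double sums of products of matrix entries, which differ only by the order of summation.\<close>

lemma trace_comp_commute:
  assumes S: "Vector_Spaces.linear scale scale S" and T: "Vector_Spaces.linear scale scale T"
  shows "trace (\<lambda>x. S (T x)) = trace (\<lambda>x. T (S x))"
proof -
  have expand: "trace (\<lambda>x. F (G x)) = (\<Sum>b\<in>Basis. \<Sum>c\<in>Basis.
      representation Basis (G b) c * representation Basis (F c) b)"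
    if F: "Vector_Spaces.linear scale scale F" for F G
  proof -
    interpret F: Vector_Spaces.linear scale scale F by fact
    have "F (G b) = (\<Sum>c\<in>Basis. scale (representation Basis (G b) c) (F c))" for b
      by (subst (1) sum_representation_Basis[of "G b", symmetric]) (simp add: F.sum F.scale)
    then show ?thesis
      by (simp add: trace_def representation_Basis_sum representation_Basis_scale)
  qed
  show ?thesis
    unfolding expand[OF S] expand[OF T] by (subst sum.swap) (simp add: mult.commute)
qed

lemma trace_eigenbasis:
  assumes "\<And>b. b \<in> Basis \<Longrightarrow> T b = scale (l b) b"
  shows "trace T = (\<Sum>b\<in>Basis. l b)"
  using assms
  by (simp add: trace_def representation_Basis_scale representation_basis independent_Basis)

end

section \<open>Bilinearity, eigenvectors of semisimple elements and the linearised Jordan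
  identity\<close>

context nonassoc_algebra
begin

lemma mult_add_right: "x \<star> (y + z) = x \<star> y + x \<star> z"
  using linear_mult_right[of x, THEN Vector_Spaces.linear.axioms(3)] by (rule module_hom.add)

lemma mult_add_left: "(x + y) \<star> z = x \<star> z + y \<star> z"
  using linear_mult_left[of z, THEN Vector_Spaces.linear.axioms(3)] by (rule module_hom.add)

lemma mult_scale_right: "x \<star> (r \<cdot> y) = r \<cdot> (x \<star> y)"
  using linear_mult_right[of x, THEN Vector_Spaces.linear.axioms(3)] by (rule module_hom.scale)

lemma mult_scale_left: "(r \<cdot> x) \<star> y = r \<cdot> (x \<star> y)"
  using linear_mult_left[of y, THEN Vector_Spaces.linear.axioms(3)] by (rule module_hom.scale)

lemma mult_zero_right: "x \<star> 0 = 0"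
  using mult_scale_right[of x 0 0] by simp

lemma mult_zero_left: "0 \<star> x = 0"
  using mult_scale_left[of 0 0 x] by simp

lemma subspace_eigenspace: "subspace (eigenspace a \<alpha>)"
  by (simp add: subspace_def eigenspace_def mult_add_right mult_scale_right mult_zero_right
      scale_right_distrib scale_left_commute)

lemma eigenspace_sum_singleton: "eigenspace_sum a {\<alpha>} = eigenspace a \<alpha>"
  by (simp add: eigenspace_sum_def subspace_eigenspace)

text \<open>Each vector lies in a stable finite-dimensional subspace with a basis of eigenvectors.
  Members of an independent set are nonzero, so their eigenvalues really belong to
  \<open>Spec a\<close>.\<close>

lemma semisimple_eigenvectors_span:
  assumes "semisimple a"
  shows "span {x. \<exists>\<alpha>\<in>Spec a. a \<star> x = \<alpha> \<cdot> x} = UNIV"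
proof -
  have "x \<in> span {x. \<exists>\<alpha>\<in>Spec a. a \<star> x = \<alpha> \<cdot> x}" for x
  proof -
    obtain W where "x \<in> W" "diagonalisable_on a W"
      using assms unfolding semisimple_def by metis
    then obtain B where B: "independent B" "x \<in> span B" "\<And>b. b \<in> B \<Longrightarrow> \<exists>\<alpha>. a \<star> b = \<alpha> \<cdot> b"
      unfolding diagonalisable_on_def by blast
    have "b \<noteq> 0" if "b \<in> B" for b
      using B(1) that dependent_zero by blast
    then have "B \<subseteq> {x. \<exists>\<alpha>\<in>Spec a. a \<star> x = \<alpha> \<cdot> x}"
      using B(3) unfolding Spec_def by blast
    then show ?thesis
      using B(2) span_mono by blast
  qed
  then show ?thesis by blast
qed

text \<open>Full polarisation of the Jordan identity, which is cubic in x: with the defect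
  \<open>A\<close> below it reads \<open>A u u u = 0\<close>, where \<open>A\<close> is trilinear
  and symmetric in its last two arguments.\<close>

lemma jordan_linearised:
  assumes jordan
  shows "(x \<star> w) \<star> (y \<star> z) + (y \<star> w) \<star> (z \<star> x) + (z \<star> w) \<star> (x \<star> y) =
    x \<star> (w \<star> (y \<star> z)) + y \<star> (w \<star> (z \<star> x)) + z \<star> (w \<star> (x \<star> y))"
    (is "?l = ?r")
proof -
  have comm: "u \<star> v = v \<star> u" for u v
    using assms by (simp add: jordan_def commutative_def)
  define A where "A u v t = (u \<star> w) \<star> (v \<star> t) - u \<star> (w \<star> (v \<star> t))" for u v t
  have sym: "A u v t = A u t v" for u v t
    by (simp add: A_def comm[of v t])
  have add: "A (u + u') v t = A u v t + A u' v t" "A u (v + v') t = A u v t + A u v' t" for u u' v v' t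
    by (simp_all add: A_def mult_add_left mult_add_right)
  have add': "A u v (t + t') = A u v t + A u v t'" for u v t t'
    by (simp add: A_def mult_add_right)
  have P: "A u u u = 0" for u
    using assms by (simp add: A_def jordan_def)
  \<comment> \<open>The mixed terms of degrees (2,1) and (1,2) vanish together. They need not be
    separated, since they occur in the same combination for each pair of variables in the expansion
    at x + y + z.\<close>
  have pol: "A u u v + A u u v + A v u u + (A v v u + A v v u + A u v v) = 0" for u v
  proof -
    have "A (u + v) (u + v) (u + v) =
        A u u v + A u u v + A v u u + (A v v u + A v v u + A u v v) + A u u u + A v v v"
      by (simp only: add add' sym ac_simps)
    then show ?thesis by (simp only: P add_0_right)
  qed
  define S where "S = A x y z + A y z x + A z x y"
  have "A (x + y + z) (x + y + z) (x + y + z) = (S + S) +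
      (A x x y + A x x y + A y x x + (A y y x + A y y x + A x y y)) +
      (A y y z + A y y z + A z y y + (A z z y + A z z y + A y z z)) +
      (A x x z + A x x z + A z x x + (A z z x + A z z x + A x z z)) +
      A x x x + A y y y + A z z z"
    unfolding S_def by (simp only: add add' sym ac_simps)
  then have "S + S = 0"
    by (simp only: P pol add_0_right)
  \<comment> \<open>The complex scalars rule out 2-torsion: S + S is (1 + 1) times S.\<close>
  then have "S = 0"
    using scale_left_distrib[of 1 1 S] by simp
  moreover have "S = ?l - ?r"
    by (simp add: S_def A_def algebra_simps)
  ultimately show ?thesis by simp
qed

end

section \<open>Associativity of the trace form, and the unit it yields\<close>

locale fd_jordan_algebra = nonassoc_algebra scale mult +
    finite_dimensional_vector_space scale Basis
  for scale :: "complex \<Rightarrow> 'a::ab_group_add \<Rightarrow> 'a"  (infixr \<open>\<cdot>\<close> 75)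
    and mult :: "'a \<Rightarrow> 'a \<Rightarrow> 'a"  (infixl \<open>\<star>\<close> 70)
    and Basis :: "'a set" +
  assumes jordan: jordan
begin

lemma mult_commute: "x \<star> y = y \<star> x"
  using jordan by (simp add: jordan_def commutative_def)

definition trace_form :: "'a \<Rightarrow> 'a \<Rightarrow> complex"
  where "trace_form x y = trace (\<lambda>z. (x \<star> y) \<star> z)"

lemma trace_form_commute: "trace_form x y = trace_form y x"
  by (simp add: trace_form_def mult_commute)

lemma trace_form_add_right: "trace_form x (y + z) = trace_form x y + trace_form x z"
  by (simp add: trace_form_def mult_add_right mult_add_left trace_add)

lemma trace_form_scale_right: "trace_form x (r \<cdot> y) = r * trace_form x y"
  by (simp add: trace_form_def mult_scale_right mult_scale_left trace_scale)

lemma trace_form_add_left: "trace_form (x + y) z = trace_form x z + trace_form y z"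
  by (simp add: trace_form_commute[of _ z] trace_form_add_right)

lemma trace_form_scale_left: "trace_form (r \<cdot> x) y = r * trace_form x y"
  by (simp add: trace_form_commute[of _ y] trace_form_scale_right)

text \<open>Reading the linearised identity as an operator identity gives
  \<open>L\<^bsub>(x y) w - (x w) y\<^esub> = [L\<^sub>x, [L\<^sub>y, L\<^sub>w]]\<close>, which has trace zero.\<close>
lemma trace_form_swap: "trace_form (x \<star> y) w = trace_form (x \<star> w) y"
proof -
  have op: "((x \<star> y) \<star> w) \<star> z - ((x \<star> w) \<star> y) \<star> z =
      (x \<star> (y \<star> (w \<star> z)) + w \<star> (y \<star> (x \<star> z))) - (x \<star> (w \<star> (y \<star> z)) + y \<star> (w \<star> (x \<star> z)))"
    (is "?a - ?b = ?c - ?d") for z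
  proof -
    \<comment> \<open>Exchanging y and w in the linearised identity leaves its left-hand side
      unchanged, so the two right-hand sides can be equated.\<close>
    have "(x \<star> w) \<star> (y \<star> z) + (y \<star> w) \<star> (x \<star> z) + (x \<star> y) \<star> (w \<star> z) = ?d + ?a"
      using jordan_linearised[OF jordan, of x w y z] by (simp add: mult_commute ac_simps)
    moreover have "(x \<star> w) \<star> (y \<star> z) + (y \<star> w) \<star> (x \<star> z) + (x \<star> y) \<star> (w \<star> z) = ?c + ?b"
      using jordan_linearised[OF jordan, of x y w z] by (simp add: mult_commute ac_simps)
    ultimately have "?d + ?a = ?c + ?b" by simp
    then show ?thesis by (simp add: algebra_simps)
  qed
  note lin = linear_mult_right Vector_Spaces.linear_compose[OF linear_mult_right linear_mult_right,
      unfolded comp_def]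
  have "trace_form (x \<star> y) w - trace_form (x \<star> w) y =
      (trace (\<lambda>z. x \<star> (y \<star> (w \<star> z))) + trace (\<lambda>z. w \<star> (y \<star> (x \<star> z)))) -
      (trace (\<lambda>z. x \<star> (w \<star> (y \<star> z))) + trace (\<lambda>z. y \<star> (w \<star> (x \<star> z))))"
    unfolding trace_form_def by (simp only: op flip: trace_diff trace_add)
  \<comment> \<open>By cyclicity of the trace the four triple products cancel in pairs: x y w
    against y w x, and w y x against x w y.\<close>
  also have "trace (\<lambda>z. x \<star> (y \<star> (w \<star> z))) = trace (\<lambda>z. y \<star> (w \<star> (x \<star> z)))"
    by (rule trace_comp_commute[OF lin(1) lin(2)])
  also have "trace (\<lambda>z. w \<star> (y \<star> (x \<star> z))) = trace (\<lambda>z. x \<star> (w \<star> (y \<star> z)))"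
    by (rule trace_comp_commute[OF lin(2) lin(1)])
  finally show ?thesis by simp
qed

lemma trace_form_assoc: "trace_form (x \<star> y) z = trace_form x (y \<star> z)"
  using trace_form_swap[of y x z] by (simp add: mult_commute trace_form_commute[of x])

lemma ideal_trace_form_radical: "ideal {x. \<forall>y. trace_form x y = 0}"
proof -
  have "trace_form 0 y = 0" for y
    using trace_form_scale_left[of 0 0 y] by simp
  then show ?thesis
    unfolding ideal_def subspace_def
    by (simp add: trace_form_add_left trace_form_scale_left trace_form_assoc mult_commute)
qed

lemma simple_unit_exists:
  assumes simple and nz: "trace_form e e \<noteq> 0"
  obtains c where "\<And>y. c \<star> y = y"
proof -
  have rad: "{x. \<forall>y. trace_form x y = 0} = {0}"
    using \<open>simple\<close> ideal_trace_form_radical nz unfolding simple_def by blast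
  have eqI: "x = y" if "\<And>z. trace_form x z = trace_form y z" for x y
  proof -
    have "trace_form (x - y) z = 0" for z
      using that[of z] trace_form_add_left[of "x - y" y z] by simp
    then have "x - y = 0" using rad by blast
    then show ?thesis by simp
  qed
  \<comment> \<open>The functional \<tau>(x, _) is stored as the vector of its values on the basis.
    Nondegeneracy makes this endomorphism injective, hence surjective, so every functional, in
    particular the trace of multiplication, is represented by some element.\<close>
  define \<phi> where "\<phi> x = (\<Sum>b\<in>Basis. trace_form x b \<cdot> b)" for x
  have rep: "representation Basis (\<Sum>b\<in>Basis. f b \<cdot> b) b = f b" if "b \<in> Basis" for f b
    using that
    by (simp add: representation_Basis_sum representation_Basis_scale representation_basis
        independent_Basis if_distrib[of "(*) _"] finite_Basis cong: if_cong)
  have expand: "f x = g x"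
    if f: "Vector_Spaces.linear scale (*) f" and g: "Vector_Spaces.linear scale (*) g"
      and eq: "\<And>b. b \<in> Basis \<Longrightarrow> f b = g b" for f g :: "'a \<Rightarrow> complex" and x
  proof -
    interpret vector_space_pair scale "(*) :: complex \<Rightarrow> _" by standard (auto simp: algebra_simps)
    show ?thesis
      by (rule linear_eq_on[OF f g, of x Basis]) (auto simp: span_Basis eq)
  qed
  have lin_form: "Vector_Spaces.linear scale (*) (trace_form x)" for x
    by unfold_locales (auto simp: trace_form_add_right trace_form_scale_right algebra_simps)
  have lin_tr: "Vector_Spaces.linear scale (*) (\<lambda>x. trace (\<lambda>z. x \<star> z))"
    by unfold_locales
      (auto simp: mult_add_left mult_scale_left trace_add trace_scale algebra_simps)
  have lin_\<phi>: "Vector_Spaces.linear scale scale \<phi>"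
    by unfold_locales
      (auto simp: \<phi>_def trace_form_add_left trace_form_scale_left scale_left_distrib
        sum.distrib scale_sum_right)
  have "inj \<phi>"
  proof (rule injI)
    fix x y assume "\<phi> x = \<phi> y"
    then have "trace_form x b = trace_form y b" if "b \<in> Basis" for b
      using rep[OF that] unfolding \<phi>_def by metis
    then have "trace_form x z = trace_form y z" for z
      by (rule expand[OF lin_form lin_form])
    then show "x = y" by (rule eqI)
  qed
  then have "surj \<phi>"
    using lin_\<phi> linear_inj_imp_surj by blast
  then obtain c where c: "\<phi> c = (\<Sum>b\<in>Basis. trace (\<lambda>z. b \<star> z) \<cdot> b)"
    by (metis surj_def)
  have "trace_form c b = trace (\<lambda>z. b \<star> z)" if "b \<in> Basis" for b
    using c rep[OF that] unfolding \<phi>_def by metis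
  then have form_c: "trace_form c x = trace (\<lambda>z. x \<star> z)" for x
    by (rule expand[OF lin_form lin_tr])
  have "c \<star> y = y" for y
  proof (rule eqI)
    fix z
    show "trace_form (c \<star> y) z = trace_form y z"
      by (simp only: trace_form_assoc form_c) (simp add: trace_form_def)
  qed
  then show ?thesis by (rule that)
qed

end

section \<open>Nondegeneracy of the trace form from a diagonalisable idempotent\<close>

context nonassoc_algebra
begin

lemma simple_jordan_unit_exists:
  assumes jordan: jordan and simple: simple and fin_dim: "finite_dimensional UNIV"
    and e: "idempotent e"
    and span: "span {x. \<exists>\<alpha>\<in>{1, 0, 1/2}. e \<star> x = \<alpha> \<cdot> x} = UNIV"
  obtains c where "\<And>y. c \<star> y = y"
proof -
  define G where "G = {x. \<exists>\<alpha>\<in>{1, 0, 1/2}. e \<star> x = \<alpha> \<cdot> x}"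
  have G: "span G = UNIV" unfolding G_def by (fact span)
  \<comment> \<open>The trace is computed in a basis selected from the eigenvectors of e, where it
    is the sum of the eigenvalues.\<close>
  obtain B where B: "B \<subseteq> G" "independent B" "G \<subseteq> span B"
    using maximal_independent_subset[of G] by metis
  have span_B: "span B = UNIV"
    using G span_minimal[OF B(3) subspace_span] by auto
  obtain F where "finite F" "span F = UNIV"
    using fin_dim unfolding finite_dimensional_def by auto
  then have "finite B"
    using independent_span_bound[of F B] B(2) by simp
  interpret fd: fd_jordan_algebra scale mult B
    by unfold_locales (rule \<open>finite B\<close> B(2) span_B jordan)+
  have "\<forall>b\<in>B. \<exists>\<alpha>. \<alpha> \<in> {1, 0, 1/2} \<and> e \<star> b = \<alpha> \<cdot> b"
    using B(1) unfolding G_def by blast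
  from bchoice[OF this] obtain l where l: "\<And>b. b \<in> B \<Longrightarrow> l b \<in> {1, 0, 1/2 :: complex}"
      "\<And>b. b \<in> B \<Longrightarrow> e \<star> b = l b \<cdot> b"
    by blast
  \<comment> \<open>If all eigenvalues vanished, multiplication by e would be zero, against e e = e
    \<noteq> 0.\<close>
  have "\<exists>b\<in>B. l b \<noteq> 0"
  proof (rule ccontr)
    assume "\<not> (\<exists>b\<in>B. l b \<noteq> 0)"
    then have "B \<subseteq> eigenspace e 0"
      using l(2) by (auto simp: eigenspace_def)
    then have "span B \<subseteq> eigenspace e 0"
      by (rule span_minimal) (rule subspace_eigenspace)
    then have "e \<star> e = 0"
      using span_B by (auto simp: eigenspace_def)
    then show False using e by (simp add: idempotent_def)
  qed
  then obtain b where b: "b \<in> B" "l b \<noteq> 0" by blast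
  \<comment> \<open>All eigenvalues are real and nonnegative, so no cancellation can occur;
    positivity is stated for real parts.\<close>
  have "0 < (\<Sum>b\<in>B. Re (l b))"
  proof (rule sum_pos2[OF \<open>finite B\<close> b(1)])
    have pos: "0 < Re z" if "z \<in> {1, 0, 1/2}" "z \<noteq> 0" for z
      using that by (elim insertE emptyE) (hypsubst, simp)+
    then show "0 < Re (l b)" using b l(1) by blast
    show "0 \<le> Re (l i)" if "i \<in> B" for i
      using pos[OF l(1)[OF that]] by (cases "l i = 0") auto
  qed
  then have "fd.trace (mult e) \<noteq> 0"
    using fd.trace_eigenbasis[of "mult e" l] l(2) by (auto simp flip: Re_sum)
  then have "fd.trace_form e e \<noteq> 0"
    using e by (simp add: fd.trace_form_def idempotent_def)
  then show ?thesis
    using fd.simple_unit_exists simple that by metis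
qed

end

section \<open>Splitting of the central extension\<close>

theorem theorem3p1:
  fixes scaleJ :: "complex \<Rightarrow> 'j::ab_group_add \<Rightarrow> 'j"
    and multJ :: "'j \<Rightarrow> 'j \<Rightarrow> 'j"
    and X :: "'j set"
  assumes algebra: "nonassoc_algebra scaleJ multJ"
    and jordan: "nonassoc_algebra.jordan multJ"
    and simple: "nonassoc_algebra.simple scaleJ multJ"
    and fin_dim: "nonassoc_algebra.finite_dimensional scaleJ (UNIV :: 'j set)"
    and X_def: "X = {a. nonassoc_algebra.idempotent multJ a}"
  shows "\<not> (\<exists>(scaleV :: complex \<Rightarrow> 'v::ab_group_add \<Rightarrow> 'v) (\<theta> :: 'j \<Rightarrow> 'j \<Rightarrow> 'v).
      vector_space scaleV \<and> (\<exists>v::'v. v \<noteq> 0) \<and>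
      bilinear_map scaleJ scaleV \<theta> \<and> (\<forall>x y. \<theta> x y = \<theta> y x) \<and>
      \<not> nonassoc_algebra.split (module_prod.scale scaleJ scaleV) (ext_mult multJ \<theta>) \<and>
      nonassoc_algebra.jordan_half_axial (module_prod.scale scaleJ scaleV) (ext_mult multJ \<theta>)
        {(a, \<theta> a a) | a. a \<in> X})"
proof (rule notI, elim exE conjE)
  fix scaleV :: "complex \<Rightarrow> 'v \<Rightarrow> 'v" and \<theta> :: "'j \<Rightarrow> 'j \<Rightarrow> 'v" and v0 :: 'v
  assume V: "vector_space scaleV" and v0: "v0 \<noteq> 0" and bil: "bilinear_map scaleJ scaleV \<theta>"
    and nonsplit: "\<not> nonassoc_algebra.split (module_prod.scale scaleJ scaleV) (ext_mult multJ \<theta>)"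
    and axial: "nonassoc_algebra.jordan_half_axial (module_prod.scale scaleJ scaleV)
      (ext_mult multJ \<theta>) {(a, \<theta> a a) | a. a \<in> X}"
  interpret J: nonassoc_algebra scaleJ multJ by fact
  interpret V: vector_space scaleV by fact
  interpret P: vector_space_prod scaleJ scaleV ..
  interpret E: nonassoc_algebra P.scale "ext_mult multJ \<theta>"
    by (rule nonassoc_algebra_central_extension[OF algebra V bil])
  have lin: "Vector_Spaces.linear scaleJ scaleV (\<theta> x)" "Vector_Spaces.linear scaleJ scaleV (\<lambda>x. \<theta> x y)"
    for x y using bil by (auto simp: bilinear_map_def)
  note th = lin[THEN Vector_Spaces.linear.axioms(3)]
  note th_add = th[THEN module_hom.add] and th_scale = th[THEN module_hom.scale]
    and th_zero = th[THEN module_hom.zero]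
  have axis: "E.jordan_half_axis (a, \<theta> a a)" if "J.idempotent a" for a
    using axial that by (auto simp: E.jordan_half_axial_def X_def)
  \<comment> \<open>Without idempotents the generated subalgebra would be zero, whereas the
    extension contains the nonzero element \<open>(0, v0)\<close>.\<close>
  have "X \<noteq> {}"
  proof
    assume "X = {}"
    then have "E.subalgebra hull {} = UNIV"
      using axial by (simp add: E.jordan_half_axial_def)
    moreover have "E.subalgebra {0}"
      by (simp add: E.subalgebra_def E.mult_zero_left)
    then have "E.subalgebra hull {} \<subseteq> {0}"
      by (rule hull_minimal[rotated]) simp
    ultimately have "(0, v0) \<in> {0 :: 'j \<times> 'v}"
      by auto
    then show False using v0 by (simp only: zero_prod_def) simp
  qed
  then obtain e where e: "J.idempotent e" by (auto simp: X_def)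
  define G where "G = {x. \<exists>\<alpha>\<in>{1, 0, 1/2}. multJ e x = scaleJ \<alpha> x}"
  \<comment> \<open>Diagonalisability descends along \<open>fst\<close>: an eigenvector of the axis
    projects to an element of \<open>G\<close>, possibly 0, and such eigenvectors span the
    extension.\<close>
  have "J.span G = UNIV"
  proof -
    let ?S = "{p. \<exists>\<alpha>\<in>E.Spec (e, \<theta> e e). ext_mult multJ \<theta> (e, \<theta> e e) p = P.scale \<alpha> p}"
    have "P.p.span ?S = UNIV"
      using axis[OF e] E.semisimple_eigenvectors_span by (simp add: E.jordan_half_axis_def)
    moreover have "?S \<subseteq> fst -` J.span G"
    proof
      fix p assume "p \<in> ?S"
      then have "fst p \<in> G"
        using axis[OF e] unfolding E.jordan_half_axis_def G_def by (auto simp: ext_mult_def P.scale_def)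
      then show "p \<in> fst -` J.span G" by (simp add: J.span_base)
    qed
    moreover have "P.p.subspace (fst -` J.span G)"
      by (auto simp: P.p.subspace_def P.scale_def J.span_zero J.span_add J.span_scale)
    ultimately have "(UNIV :: ('j \<times> 'v) set) \<subseteq> fst -` J.span G"
      using P.p.span_minimal[of ?S "fst -` J.span G"] by simp
    then have "x \<in> J.span G" for x
      using subsetD[of UNIV "fst -` J.span G" "(x, 0 :: 'v)"] by simp
    then show ?thesis by blast
  qed
  then obtain c where c: "\<And>y. multJ c y = y"
    using J.simple_jordan_unit_exists[OF jordan simple fin_dim e] unfolding G_def by metis
  have "c \<noteq> 0"
    using c[of e] e by (auto simp: J.idempotent_def J.mult_zero_left)
  then have "J.idempotent c"
    using c by (simp add: J.idempotent_def)
  note ax = axis[OF this]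
  \<comment> \<open>Since c is a unit, each \<open>(z, \<theta> c z)\<close> is a 1-eigenvector of
    the axis over c. The product of two of them, \<open>(multJ x y, \<theta> x y)\<close>, is again
    one by the fusion law; the claim is the second component of its eigenvector equation.\<close>
  have coboundary: "\<theta> x y = \<theta> c (multJ x y)" for x y
  proof -
    let ?c = "(c, \<theta> c c)"
    have eig: "(z, \<theta> c z) \<in> E.eigenspace ?c 1" for z
      by (simp add: E.eigenspace_def ext_mult_def c)
    have "1 \<in> E.Spec ?c"
      using eig[of c] \<open>c \<noteq> 0\<close> by (auto simp: E.eigenspace_def E.Spec_def zero_prod_def)
    then have "ext_mult multJ \<theta> (x, \<theta> c x) (y, \<theta> c y) \<in> E.eigenspace_sum ?c (jordan_half_fusion 1 1)"
      using ax eig unfolding E.jordan_half_axis_def by blast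
    then show ?thesis
      by (simp add: jordan_half_fusion_def E.eigenspace_sum_singleton E.eigenspace_def ext_mult_def)
  qed
  \<comment> \<open>The complement of the copy \<open>I'\<close> of V is the graph of the linear map
    \<open>\<theta> c\<close>. By \<open>coboundary\<close> it contains every product of the
    extension, hence is an ideal.\<close>
  define I where "I = {p. snd p = \<theta> c (fst p)}"
  define I' where "I' = {p :: 'j \<times> 'v. fst p = 0}"
  have I: "P.p.subspace I"
    by (simp add: P.p.subspace_def I_def P.scale_def th_zero th_add th_scale)
  have "E.ideal I"
    using I by (simp add: E.ideal_def) (simp add: I_def ext_mult_def flip: coboundary)
  moreover have "E.subalgebra I'"
    by (simp add: E.subalgebra_def P.p.subspace_def I'_def ext_mult_def P.scale_def J.mult_zero_left)
  moreover have "I' \<subseteq> E.Ann"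
    by (auto simp: E.Ann_def I'_def ext_mult_def prod_eq_iff J.mult_zero_left J.mult_zero_right th_zero)
  moreover have "I' \<noteq> {0}"
  proof -
    have "(0, v0) \<in> I'" by (simp add: I'_def)
    moreover have "(0, v0) \<noteq> (0 :: 'j \<times> 'v)" using v0 by (simp add: prod_eq_iff)
    ultimately show ?thesis by blast
  qed
  moreover have "{p + q | p q. p \<in> I \<and> q \<in> I'} = UNIV"
  proof -
    have "\<exists>p q. r = p + q \<and> p \<in> I \<and> q \<in> I'" for r
      by (rule exI[of _ "(fst r, \<theta> c (fst r))"], rule exI[of _ "(0, snd r - \<theta> c (fst r))"])
        (simp add: I_def I'_def prod_eq_iff)
    then show ?thesis by blast
  qed
  moreover have "I \<inter> I' = {0}"
    by (auto simp: I_def I'_def prod_eq_iff th_zero)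
  ultimately have "E.split"
    unfolding E.split_def E.direct_sum_def
    by (intro exI[of _ I] exI[of _ I']) (auto simp: E.ideal_def E.subalgebra_def E.Ann_def subset_iff)
  then show False using nonsplit by blast
qed

end
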